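(* It is not true that, for every double $i$-string $T_0,\dots,T_{2k}$, the cells $C_{T_{2j}}$ and $C_{T_{2j+2}}$ are always faces of $C_{T_{2j+1}}$. Namely, let $\lambda=(2,1,0)$, $n=3$, $i=2$, and write a set-valued tableau $T$ of shape $(2,1)$ as $A\,B/C$ with $A=T(1,1)$, $B=T(1,2)$, $C=T(2,1)$, listing elements of sets without braces. Then $$T_0=1\,2/23\ \xrightarrow{\,f'_2\,}\ T_1=1\,23/23\ \xrightarrow{\,f'_2\,}\ T_2=1\,23/3$$ is a double $2$-string, and $\overline{C_{T_1}}\cap\overline{C_{T_2}}=\varnothing$; in particular $C_{T_2}$ is not a face of $C_{T_1}$.
   Context: Fix $n\ge1$, a partition $\lambda=(\lambda_1\ge\dots\ge\lambda_n\ge0)$, $[n]=\{1,\dots,n\}$. The Young diagram of $\lambda$ (English convention) has cells $(r,c)$, $1\le r\le n$, $1\le c\le\lambda_r$. Bars denote topological closure in $\mathbb R^{n(n-1)/2}$. A cell $C$ being a face of a cell $C'$ means in particular $C\subseteq\overline{C'}$. **Set-valued tableaux.** A set-valued tableau of shape $\lambda$ is a filling $T$ of the cells by non-empty subsets of $[n]$ such that $\max T(r,c)\le\min T(r,c+1)$ and $\max T(r,c)<\min T(r+1,c)$ whenever both cells exist. $\mathrm{SVT}_n(\lambda)$ is the set of these. **Operators (Yu).** Fix $i\in[n-1]$. Read the cells of $T$ column by column from left to right, each column from bottom to top. Each cell contributes: ")" if it contains $i$ but not $i+1$; "(" if it contains $i+1$ but not $i$; the string ")-(" if it contains both; nothing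 otherwise. Match brackets in the usual way (a "(" with a later ")"), ignoring dashes. The classes are the equivalence classes of brackets generated by: two matched brackets are equivalent, and two brackets joined by a dash are equivalent. A class (read left to right) is of right form if it begins with an unmatched ")" and does not end with an unmatched "("; of left form if it ends with an unmatched "(" and does not begin with an unmatched ")"; of combined form if it begins with an unmatched ")" and ends with an unmatched "(". $f'_i(T)$: if a class of combined form occurs, delete $i$ from the cell contributing the initial ")" of the first such class; otherwise add $i+1$ to the cell contributing the final ")" of the last class of right form; $f'_i(T)=0$ if there is none. $e'_i(T)$ is defined symmetrically: if a class of combined form occurs, delete $i+1$ from the cell contributing the final "(" of the last such class; otherwise add $i$ to the cell contributing the initial "(" of the first class of left form; $e'_i(T)=0$ if there is none. A double $i$-string is a maximal sequence $T_0,\dots,T_{2k}$ in $\mathrm{SVT}_n(\lambda)$ with $e'_i(T_0)=f'_i(T_{2k})=0$ and $f'_i(T_j)=T_{j+1}$ for $0\le j<2k$. **Gelfand–Zetlin patterns.** A Gelfand–Zetlin pattern with top row $\lambda$ is an array of integers $a_{ij}$ ($0\le i\le n-1$, $1\le j\le n-i$) with $a_{0,j}=\lambda_{n+1-j}$ and $a_{i-1,j}\le a_{ij}\le a_{i-1,j+1}$ for $i\ge1$. $GZ(\lambda)\subset\mathbb R^{n(n-1)/2}$ is the polytope of real points $(y_{ij})_{1\le i\le n-1,1\le j\le n-i}$ satisfying $y_{i-1,j}\le y_{ij}\le y_{i-1,j+1}$, with $y_{0,j}=\lambda_{n+1-j}$. **Enhancement attached to $T$.** For $0\le k\le n$ let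 $\nu^{(k)}(T)$ be the partition formed by the cells with $\min T(r,c)\le k$; put $a_{ij}=\nu^{(k)}_r(T)$ with $k=n-i$, $r=k-j+1$; this is a Gelfand–Zetlin pattern. Let $U(T)$ be the set of positions $(n-k,k-r+1)$ such that $1\le k\le n-1$ and the letter $k+1$ is a non-minimal element of some cell in row $r$ of $T$. Encircle all positions outside $U(T)$, and draw edges by the following procedure: equal neighboring entries of row $0$ are declared connected; scan rows from top to bottom; from an encircled $(i,j)$, $i\ge1$: if $a_{ij}$ equals neither $a_{i-1,j}$ nor $a_{i-1,j+1}$, draw no edge upwards; if it equals exactly one of them, join $(i,j)$ to that one; if it equals both, join $(i,j)$ to both when $(i-1,j)$ and $(i-1,j+1)$ are already joined by a path of edges lying in rows $\le i-1$ (connections declared in row $0$ count), and to $(i-1,j+1)$ alone otherwise. Non-encircled entries receive no upward edges. The result is denoted $P=\widetilde\Phi(T)$. **Cells.** For each $(i,j)$, $i\ge1$, impose: (1) for an edge from $(i,j)$ to $(i-1,j)$ (resp. $(i-1,j+1)$), $y_{ij}=y_{i-1,j}$ (resp. $y_{ij}=y_{i-1,j+1}$); (2) if no edge goes up from $(i,j)$ and it is encircled, $y_{ij}=a_{ij}$; (3) if no edge goes up and it is not encircled, the strict inequalities: $a_{ij}-1<y_{ij}$ if $a_{ij}-a_{i-1,j}\ge2$ and $y_{i-1,j}<y_{ij}$ otherwise; $y_{ij}<y_{i-1,j+1}$ if $a_{i-1,j+1}=a_{ij}$ and $y_{ij}<a_{ij}$ otherwise. Let $\widehat{C_P}$ be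 the set so defined, $L$ its affine span, and $C_T:=C_P=\widehat{C_P}\cap(GZ(\lambda)\cap L)^\circ$ (relative interior in $L$). *)

theory Defs
  imports "HOL-Analysis.Analysis"
begin

section \<open>Set-valued tableaux\<close>

text \<open>A partition is the weakly decreasing list of its \<open>n\<close> parts, zeros included.\<close>

definition is_partition :: "nat \<Rightarrow> nat list \<Rightarrow> bool" where
  "is_partition n lam \<longleftrightarrow> length lam = n \<and> sorted_wrt (\<ge>) lam"

definition row_len :: "nat list \<Rightarrow> nat \<Rightarrow> nat" where
  "row_len lam r = lam ! (r - 1)"

definition diagram :: "nat \<Rightarrow> nat list \<Rightarrow> (nat \<times> nat) set" where
  "diagram n lam = {(r, c). 1 \<le> r \<and> r \<le> n \<and> 1 \<le> c \<and> c \<le> row_len lam r}"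

type_synonym tableau = "nat \<times> nat \<Rightarrow> nat set"

text \<open>A tableau takes the junk value \<open>{}\<close> off its diagram, so that equality of
  tableaux is equality of functions.\<close>

definition SVT :: "nat \<Rightarrow> nat list \<Rightarrow> tableau set" where
  "SVT n lam = {T.
     (\<forall>p \<in> diagram n lam. T p \<noteq> {} \<and> T p \<subseteq> {1..n}) \<and>
     (\<forall>p. p \<notin> diagram n lam \<longrightarrow> T p = {}) \<and>
     (\<forall>r c. (r, c) \<in> diagram n lam \<and> (r, c + 1) \<in> diagram n lam \<longrightarrow>
        Max (T (r, c)) \<le> Min (T (r, c + 1))) \<and>
     (\<forall>r c. (r, c) \<in> diagram n lam \<and> (r + 1, c) \<in> diagram n lam \<longrightarrow>
        Max (T (r, c)) < Min (T (r + 1, c)))}"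


section \<open>Bracket words and the operators\<close>

datatype bracket = Opening | Closing

definition reading_order :: "nat \<Rightarrow> nat list \<Rightarrow> (nat \<times> nat) list" where
  "reading_order n lam =
     [(r, c). c \<leftarrow> [1..<row_len lam 1 + 1], r \<leftarrow> rev [1..<n + 1], c \<le> row_len lam r]"

definition contribution :: "nat \<Rightarrow> tableau \<Rightarrow> nat \<times> nat \<Rightarrow> (bracket \<times> nat \<times> nat) list" where
  "contribution i T p =
     (if i \<in> T p then [(Closing, p)] else []) @ (if i + 1 \<in> T p then [(Opening, p)] else [])"

text \<open>Every bracket carries the cell that contributes it; a dash joins two adjacent brackets
  exactly when they come from the same cell, so dashes need not be recorded separately.\<close>

type_synonym word = "(bracket \<times> nat \<times> nat) list"

definition word_of :: "nat \<Rightarrow> nat list \<Rightarrow> nat \<Rightarrow> tableau \<Rightarrow> word" where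
  "word_of n lam i T = concat (map (contribution i T) (reading_order n lam))"

definition dashes :: "word \<Rightarrow> (nat \<times> nat) set" where
  "dashes w = {(p, p + 1) | p. p + 1 < length w \<and> snd (w ! p) = snd (w ! (p + 1))}"

text \<open>Bracket matching with a stack of the positions of the pending opening brackets;
  \<open>k\<close> is the position of the head of the remaining word.\<close>

fun match_from :: "nat list \<Rightarrow> nat \<Rightarrow> bracket list \<Rightarrow> (nat \<times> nat) set" where
  "match_from st k [] = {}"
| "match_from st k (Opening # bs) = match_from (k # st) (k + 1) bs"
| "match_from [] k (Closing # bs) = match_from [] (k + 1) bs"
| "match_from (p # st) k (Closing # bs) = insert (p, k) (match_from st (k + 1) bs)"

definition matching :: "word \<Rightarrow> (nat \<times> nat) set" where
  "matching w = match_from [] 0 (map fst w)"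

definition unmatched :: "word \<Rightarrow> nat \<Rightarrow> bool" where
  "unmatched w p \<longleftrightarrow> p < length w \<and> (\<forall>q. (p, q) \<notin> matching w \<and> (q, p) \<notin> matching w)"

definition bracket_equiv :: "word \<Rightarrow> (nat \<times> nat) set" where
  "bracket_equiv w =
     (let R = matching w \<union> dashes w in (R \<union> R\<inverse>)\<^sup>* \<inter> {..<length w} \<times> {..<length w})"

definition bracket_classes :: "word \<Rightarrow> nat set set" where
  "bracket_classes w = {..<length w} // bracket_equiv w"

definition begins_unmatched_closing :: "word \<Rightarrow> nat set \<Rightarrow> bool" where
  "begins_unmatched_closing w X \<longleftrightarrow> unmatched w (Min X) \<and> fst (w ! Min X) = Closing"

definition ends_unmatched_opening :: "word \<Rightarrow> nat set \<Rightarrow> bool" where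
  "ends_unmatched_opening w X \<longleftrightarrow> unmatched w (Max X) \<and> fst (w ! Max X) = Opening"

definition right_form :: "word \<Rightarrow> nat set set" where
  "right_form w = {X \<in> bracket_classes w.
     begins_unmatched_closing w X \<and> \<not> ends_unmatched_opening w X}"

definition left_form :: "word \<Rightarrow> nat set set" where
  "left_form w = {X \<in> bracket_classes w.
     ends_unmatched_opening w X \<and> \<not> begins_unmatched_closing w X}"

definition combined_form :: "word \<Rightarrow> nat set set" where
  "combined_form w = {X \<in> bracket_classes w.
     begins_unmatched_closing w X \<and> ends_unmatched_opening w X}"

text \<open>Classes of one and the same form occupy disjoint stretches of the word: no arc of the
  matching passes over an unmatched bracket. Hence ordering them by their first bracket is
  the only possible reading of ``first'' and ``last''.\<close>

definition first_class :: "nat set set \<Rightarrow> nat set" where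
  "first_class XS = arg_min Min (\<lambda>X. X \<in> XS)"

definition last_class :: "nat set set \<Rightarrow> nat set" where
  "last_class XS = arg_max Min (\<lambda>X. X \<in> XS)"

definition initial_closing_cell :: "word \<Rightarrow> nat set \<Rightarrow> nat \<times> nat" where
  "initial_closing_cell w X = snd (w ! Min {p \<in> X. fst (w ! p) = Closing})"

definition final_closing_cell :: "word \<Rightarrow> nat set \<Rightarrow> nat \<times> nat" where
  "final_closing_cell w X = snd (w ! Max {p \<in> X. fst (w ! p) = Closing})"

definition initial_opening_cell :: "word \<Rightarrow> nat set \<Rightarrow> nat \<times> nat" where
  "initial_opening_cell w X = snd (w ! Min {p \<in> X. fst (w ! p) = Opening})"

definition final_opening_cell :: "word \<Rightarrow> nat set \<Rightarrow> nat \<times> nat" where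
  "final_opening_cell w X = snd (w ! Max {p \<in> X. fst (w ! p) = Opening})"

definition delete_letter :: "nat \<Rightarrow> nat \<times> nat \<Rightarrow> tableau \<Rightarrow> tableau" where
  "delete_letter x p T = T(p := T p - {x})"

definition add_letter :: "nat \<Rightarrow> nat \<times> nat \<Rightarrow> tableau \<Rightarrow> tableau" where
  "add_letter x p T = T(p := insert x (T p))"

text \<open>\<open>None\<close> plays the role of \<open>0\<close>.\<close>

definition f_op :: "nat \<Rightarrow> nat list \<Rightarrow> nat \<Rightarrow> tableau \<Rightarrow> tableau option" where
  "f_op n lam i T = (let w = word_of n lam i T in
     if combined_form w \<noteq> {} then
       Some (delete_letter i (initial_closing_cell w (first_class (combined_form w))) T)
     else if right_form w \<noteq> {} then
       Some (add_letter (i + 1) (final_closing_cell w (last_class (right_form w))) T)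
     else None)"

definition e_op :: "nat \<Rightarrow> nat list \<Rightarrow> nat \<Rightarrow> tableau \<Rightarrow> tableau option" where
  "e_op n lam i T = (let w = word_of n lam i T in
     if combined_form w \<noteq> {} then
       Some (delete_letter (i + 1) (final_opening_cell w (last_class (combined_form w))) T)
     else if left_form w \<noteq> {} then
       Some (add_letter i (initial_opening_cell w (first_class (left_form w))) T)
     else None)"

text \<open>The list \<open>Ts\<close> is \<open>T\<^sub>0, \<dots>, T\<^sub>2\<^sub>k\<close>. Maximality means that the sequence cannot be prolonged at
  either end; at the right end this is the condition that \<open>f_op\<close> vanishes.\<close>

definition double_string :: "nat \<Rightarrow> nat list \<Rightarrow> nat \<Rightarrow> tableau list \<Rightarrow> bool" where
  "double_string n lam i Ts \<longleftrightarrow>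
     odd (length Ts) \<and> set Ts \<subseteq> SVT n lam \<and>
     e_op n lam i (hd Ts) = None \<and> f_op n lam i (last Ts) = None \<and>
     (\<forall>j. j + 1 < length Ts \<longrightarrow> f_op n lam i (Ts ! j) = Some (Ts ! (j + 1))) \<and>
     (\<forall>S \<in> SVT n lam. f_op n lam i S \<noteq> Some (hd Ts))"


section \<open>Enhanced Gelfand--Zetlin patterns\<close>

text \<open>\<open>nu n lam T k r\<close> is the length of row \<open>r\<close> of the partition formed by the cells whose
  minimum is at most \<open>k\<close>.\<close>

definition nu :: "nat \<Rightarrow> nat list \<Rightarrow> tableau \<Rightarrow> nat \<Rightarrow> nat \<Rightarrow> nat" where
  "nu n lam T k r = card {c. (r, c) \<in> diagram n lam \<and> Min (T (r, c)) \<le> k}"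

text \<open>An edge \<open>(p, q)\<close> is directed upwards, from \<open>p\<close> to \<open>q\<close>, except within row \<open>0\<close>.\<close>

record enhanced_pattern =
  entry :: "nat \<times> nat \<Rightarrow> int"
  encircled :: "(nat \<times> nat) set"
  edges :: "((nat \<times> nat) \<times> (nat \<times> nat)) set"

definition gz_entry :: "nat \<Rightarrow> nat list \<Rightarrow> tableau \<Rightarrow> nat \<times> nat \<Rightarrow> int" where
  "gz_entry n lam T = (\<lambda>(i, j). int (nu n lam T (n - i) (n - i - j + 1)))"

definition nonminimal_positions :: "nat \<Rightarrow> nat list \<Rightarrow> tableau \<Rightarrow> (nat \<times> nat) set" where
  "nonminimal_positions n lam T =
     {(n - k, k - r + 1) | k r. 1 \<le> k \<and> k \<le> n - 1 \<and>
        (\<exists>c. (r, c) \<in> diagram n lam \<and> k + 1 \<in> T (r, c) \<and> k + 1 \<noteq> Min (T (r, c)))}"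

definition all_positions :: "nat \<Rightarrow> (nat \<times> nat) set" where
  "all_positions n = {(i, j). i \<le> n - 1 \<and> 1 \<le> j \<and> j \<le> n - i}"

definition connected_by :: "('p \<times> 'p) set \<Rightarrow> 'p \<Rightarrow> 'p \<Rightarrow> bool" where
  "connected_by E p q \<longleftrightarrow> (p, q) \<in> (E \<union> E\<inverse>)\<^sup>*"

text \<open>Targets of the edges going up from the encircled position \<open>(i, j)\<close>, where \<open>E\<close> is the set
  of edges lying in the rows above row \<open>i\<close>.\<close>

definition up_targets ::
    "(nat \<times> nat \<Rightarrow> int) \<Rightarrow> ((nat \<times> nat) \<times> (nat \<times> nat)) set \<Rightarrow> nat \<Rightarrow> nat \<Rightarrow> (nat \<times> nat) set" where
  "up_targets a E i j =
     (if a (i, j) = a (i - 1, j) \<and> a (i, j) = a (i - 1, j + 1) then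
        (if connected_by E (i - 1, j) (i - 1, j + 1) then {(i - 1, j), (i - 1, j + 1)}
         else {(i - 1, j + 1)})
      else if a (i, j) = a (i - 1, j) then {(i - 1, j)}
      else if a (i, j) = a (i - 1, j + 1) then {(i - 1, j + 1)}
      else {})"

fun edges_upto ::
    "nat \<Rightarrow> (nat \<times> nat \<Rightarrow> int) \<Rightarrow> (nat \<times> nat) set \<Rightarrow> nat \<Rightarrow> ((nat \<times> nat) \<times> (nat \<times> nat)) set" where
  "edges_upto n a circ 0 = {((0, j), (0, j + 1)) | j. 1 \<le> j \<and> j < n \<and> a (0, j) = a (0, j + 1)}"
| "edges_upto n a circ (Suc i) = edges_upto n a circ i \<union>
     {((Suc i, j), q) | j q. (Suc i, j) \<in> circ \<and> q \<in> up_targets a (edges_upto n a circ i) (Suc i) j}"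

definition Phi :: "nat \<Rightarrow> nat list \<Rightarrow> tableau \<Rightarrow> enhanced_pattern" where
  "Phi n lam T =
     (let a = gz_entry n lam T; circ = all_positions n - nonminimal_positions n lam T
      in \<lparr>entry = a, encircled = circ, edges = edges_upto n a circ (n - 1)\<rparr>)"


section \<open>Cells\<close>

text \<open>Since \<open>n\<close> is not fixed, the Euclidean space of dimension \<open>n(n-1)/2\<close> is rendered as the
  product space of real families indexed by the positions in the rows below row \<open>0\<close>.\<close>

type_synonym point = "nat \<times> nat \<Rightarrow> real"

definition gz_index :: "nat \<Rightarrow> (nat \<times> nat) set" where
  "gz_index n = {(i, j). 1 \<le> i \<and> i \<le> n - 1 \<and> 1 \<le> j \<and> j \<le> n - i}"

abbreviation gz_space :: "nat \<Rightarrow> point topology" where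
  "gz_space n \<equiv> product_topology (\<lambda>_. euclideanreal) (gz_index n)"

definition with_top_row :: "nat list \<Rightarrow> nat \<Rightarrow> point \<Rightarrow> point" where
  "with_top_row lam n y = (\<lambda>(i, j). if i = 0 then real (row_len lam (n + 1 - j)) else y (i, j))"

definition GZ :: "nat \<Rightarrow> nat list \<Rightarrow> point set" where
  "GZ n lam = {y \<in> topspace (gz_space n). \<forall>(i, j) \<in> gz_index n.
     let Y = with_top_row lam n y in Y (i - 1, j) \<le> Y (i, j) \<and> Y (i, j) \<le> Y (i - 1, j + 1)}"

text \<open>The counterparts of \<^const>\<open>affine\<close> and the affine hull (\<^const>\<open>hull\<close>) for families indexed by a set.\<close>

definition affine_in :: "'i set \<Rightarrow> ('i \<Rightarrow> real) set \<Rightarrow> bool" where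
  "affine_in I S \<longleftrightarrow>
     (\<forall>x \<in> S. \<forall>y \<in> S. \<forall>u v. u + v = 1 \<longrightarrow> (\<lambda>p \<in> I. u * x p + v * y p) \<in> S)"

definition affine_span :: "'i set \<Rightarrow> ('i \<Rightarrow> real) set \<Rightarrow> ('i \<Rightarrow> real) set" where
  "affine_span I S = affine_in I hull S"

definition pre_cell :: "nat \<Rightarrow> nat list \<Rightarrow> enhanced_pattern \<Rightarrow> point set" where
  "pre_cell n lam P = {y \<in> topspace (gz_space n). \<forall>(i, j) \<in> gz_index n.
     let a = entry P; Y = with_top_row lam n y; up = {q. ((i, j), q) \<in> edges P} in
       (\<forall>q \<in> up. Y (i, j) = Y q) \<and>
       (up = {} \<and> (i, j) \<in> encircled P \<longrightarrow> Y (i, j) = of_int (a (i, j))) \<and>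
       (up = {} \<and> (i, j) \<notin> encircled P \<longrightarrow>
          (if a (i, j) - a (i - 1, j) \<ge> 2 then of_int (a (i, j)) - 1 < Y (i, j)
           else Y (i - 1, j) < Y (i, j)) \<and>
          (if a (i - 1, j + 1) = a (i, j) then Y (i, j) < Y (i - 1, j + 1)
           else Y (i, j) < of_int (a (i, j))))}"

definition cell_of_pattern :: "nat \<Rightarrow> nat list \<Rightarrow> enhanced_pattern \<Rightarrow> point set" where
  "cell_of_pattern n lam P =
     (let L = affine_span (gz_index n) (pre_cell n lam P)
      in pre_cell n lam P \<inter> (subtopology (gz_space n) L interior_of (GZ n lam \<inter> L)))"

definition cell_of :: "nat \<Rightarrow> nat list \<Rightarrow> tableau \<Rightarrow> point set" where
  "cell_of n lam T = cell_of_pattern n lam (Phi n lam T)"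

abbreviation cell_closure :: "nat \<Rightarrow> point set \<Rightarrow> point set" where
  "cell_closure n C \<equiv> gz_space n closure_of C"

text \<open>The only property of ``being a face of'' that is fixed here is that a face lies in the closure;
  \<open>face_of_cell n lam C C'\<close> means that \<open>C\<close> is a face of \<open>C'\<close>.\<close>

definition is_face_notion :: "(nat \<Rightarrow> nat list \<Rightarrow> point set \<Rightarrow> point set \<Rightarrow> bool) \<Rightarrow> bool" where
  "is_face_notion face_of_cell \<longleftrightarrow>
     (\<forall>n lam. \<forall>T \<in> SVT n lam. \<forall>T' \<in> SVT n lam. n \<ge> 1 \<and> is_partition n lam \<and>
        face_of_cell n lam (cell_of n lam T) (cell_of n lam T') \<longrightarrow>
        cell_of n lam T \<subseteq> cell_closure n (cell_of n lam T'))"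

text \<open>The filling \<open>A B / C\<close> of the diagram of \<open>(2, 1, 0)\<close>.\<close>

definition tab21 :: "nat set \<Rightarrow> nat set \<Rightarrow> nat set \<Rightarrow> tableau" where
  "tab21 A B C = (\<lambda>_. {})((1, 1) := A, (1, 2) := B, (2, 1) := C)"

end

theory Submission
  imports Defs
begin

text \<open>
  The minimum of the cell \<open>(2, 1)\<close> is \<open>2\<close> in \<open>T\<^sub>1 = 1 23/23\<close> and \<open>3\<close> in \<open>T\<^sub>2 = 1 23/3\<close>. Deleting a
  minimum, as \<open>f_op\<close> does here, changes the Gelfand--Zetlin
  pattern itself, not just its enhancement. Below the top row \<open>0 1 2\<close> the patterns are

    \<^item> for \<open>T\<^sub>1\<close>: \<open>1 2\<close> over \<open>1\<close>, where both entries of row 1 lack a circle and the last entry is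
      joined to its upper left neighbour, so that the cell is
      \<open>0 < y\<^sub>1\<^sub>1 < 1 < y\<^sub>1\<^sub>2 < 2\<close>, \<open>y\<^sub>2\<^sub>1 = y\<^sub>1\<^sub>1\<close>;
    \<^item> for \<open>T\<^sub>2\<close>: \<open>0 2\<close> over \<open>1\<close>, where only the entry 2 lacks a circle and the encircled last entry
      equals none of its upper neighbours, so that the cell is
      \<open>y\<^sub>1\<^sub>1 = 0\<close>, \<open>1 < y\<^sub>1\<^sub>2 < 2\<close>, \<open>y\<^sub>2\<^sub>1 = 1\<close>.

  The continuous function \<open>y\<^sub>2\<^sub>1 - y\<^sub>1\<^sub>1\<close> is constantly \<open>0\<close> on the first cell and constantly \<open>1\<close> on the
  second, hence on their closures, which are therefore disjoint (\<open>closures_disjoint\<close>). As the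
  second cell is not empty (\<open>cell_T2_nonempty\<close>), it does not lie in the closure of the first, and
  no notion of face that implies this inclusion can hold between them.

  That \<open>T\<^sub>0, T\<^sub>1, T\<^sub>2\<close> is a double string (\<open>double_string_T\<close>) rests on the bracket words
  \<open>)-( )\<close>, \<open>)-( )-(\<close> and \<open>( )-(\<close>. In each of them neighbouring brackets are matched or joined by a
  dash, so the word is one single class, of right, combined and left form respectively, and the
  operators can be read off. Maximality at the left end is a statement about all tableaux; it
  holds because an operator changes one cell only, which leaves just \<open>T\<^sub>0\<close> and \<open>1 2/2\<close> as
  possible preimages of \<open>T\<^sub>0\<close>.
\<close>

section \<open>Set-valued tableaux of shape (2, 1, 0)\<close>

lemma diagram_210: "diagram 3 [2, 1, 0] = {(1, 1), (1, 2), (2, 1)}"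
proof (intro set_eqI)
  fix p :: "nat \<times> nat"
  obtain r c where p: "p = (r, c)" by force
  have "1 \<le> r \<and> r \<le> 3 \<longleftrightarrow> r = 1 \<or> r = 2 \<or> r = 3" by auto
  then show "p \<in> diagram 3 [2, 1, 0] \<longleftrightarrow> p \<in> {(1, 1), (1, 2), (2, 1)}"
    unfolding p diagram_def row_len_def by (auto simp: numeral_eq_Suc)
qed

lemma tab21_apply [simp]:
  "tab21 A B C (1, 1) = A" "tab21 A B C (Suc 0, Suc 0) = A"
  "tab21 A B C (1, 2) = B" "tab21 A B C (Suc 0, 2) = B"
  "tab21 A B C (2, 1) = C" "tab21 A B C (2, Suc 0) = C"
  by (auto simp: tab21_def)

lemma tab21_outside: "p \<notin> diagram 3 [2, 1, 0] \<Longrightarrow> tab21 A B C p = {}"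
  unfolding diagram_210 by (auto simp: tab21_def)

lemma tab21_in_SVT_iff:
  "tab21 A B C \<in> SVT 3 [2, 1, 0] \<longleftrightarrow>
     A \<noteq> {} \<and> B \<noteq> {} \<and> C \<noteq> {} \<and> A \<subseteq> {1..3} \<and> B \<subseteq> {1..3} \<and> C \<subseteq> {1..3} \<and>
     Max A \<le> Min B \<and> Max A < Min C"
proof -
  have "(r, c) \<in> diagram 3 [2, 1, 0] \<and> (r, c + 1) \<in> diagram 3 [2, 1, 0] \<longleftrightarrow> r = 1 \<and> c = 1"
    for r c unfolding diagram_210 by auto
  then have rows: "(\<forall>r c. (r, c) \<in> diagram 3 [2, 1, 0] \<and> (r, c + 1) \<in> diagram 3 [2, 1, 0] \<longrightarrow>
      Max (tab21 A B C (r, c)) \<le> Min (tab21 A B C (r, c + 1))) \<longleftrightarrow> Max A \<le> Min B"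
    by (simp add: numeral_2_eq_2[symmetric])
  have "(r, c) \<in> diagram 3 [2, 1, 0] \<and> (r + 1, c) \<in> diagram 3 [2, 1, 0] \<longleftrightarrow> r = 1 \<and> c = 1"
    for r c unfolding diagram_210 by auto
  then have columns:
    "(\<forall>r c. (r, c) \<in> diagram 3 [2, 1, 0] \<and> (r + 1, c) \<in> diagram 3 [2, 1, 0] \<longrightarrow>
      Max (tab21 A B C (r, c)) < Min (tab21 A B C (r + 1, c))) \<longleftrightarrow> Max A < Min C"
    by (simp add: numeral_2_eq_2[symmetric])
  have cells:
    "(\<forall>p \<in> diagram 3 [2, 1, 0]. tab21 A B C p \<noteq> {} \<and> tab21 A B C p \<subseteq> {1..3}) \<longleftrightarrow>
      A \<noteq> {} \<and> B \<noteq> {} \<and> C \<noteq> {} \<and> A \<subseteq> {1..3} \<and> B \<subseteq> {1..3} \<and> C \<subseteq> {1..3}"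
    unfolding diagram_210 by auto
  have outside: "(\<forall>p. p \<notin> diagram 3 [2, 1, 0] \<longrightarrow> tab21 A B C p = {}) \<longleftrightarrow> True"
    by (simp add: tab21_outside)
  show ?thesis
    unfolding SVT_def mem_Collect_eq rows columns cells outside
    by (simp only: simp_thms conj_assoc)
qed

lemma SVT_210_is_tab21:
  assumes "T \<in> SVT 3 [2, 1, 0]"
  obtains A B C where "T = tab21 A B C"
proof -
  have outside: "\<forall>p. p \<notin> diagram 3 [2, 1, 0] \<longrightarrow> T p = {}"
    using assms unfolding SVT_def by (elim CollectE conjE)
  have "T p = tab21 (T (1, 1)) (T (1, 2)) (T (2, 1)) p" for p
  proof (cases "p \<in> diagram 3 [2, 1, 0]")
    case True
    then show ?thesis unfolding diagram_210 by (elim insertE emptyE) simp_all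
  next
    case False
    show ?thesis using outside[rule_format, OF False] tab21_outside[OF False] by simp
  qed
  then show thesis by (intro that ext)
qed

section \<open>Brackets\<close>

lemma word_of_tab21:
  "word_of 3 [2, 1, 0] i (tab21 A B C) =
     contribution i (tab21 A B C) (2, 1) @ contribution i (tab21 A B C) (1, 1) @
     contribution i (tab21 A B C) (1, 2)"
  by (simp add: word_of_def reading_order_def row_len_def upt_rec numeral_eq_Suc)

text \<open>Neighbouring positions generate all of the word by transitivity.\<close>

lemma bracket_classes_connected:
  assumes "w \<noteq> []"
    and step: "\<And>p. p + 1 < length w \<Longrightarrow> (p, p + 1) \<in> matching w \<union> dashes w"
  shows "bracket_classes w = {{..<length w}}"
proof -
  define R where "R = matching w \<union> dashes w"
  have up: "(0, p) \<in> (R \<union> R\<inverse>)\<^sup>*" if "p < length w" for p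
    using that
  proof (induction p)
    case (Suc p)
    then have "(p, Suc p) \<in> R" using step[of p] by (simp add: R_def)
    with Suc show ?case by (auto intro: rtrancl_into_rtrancl)
  qed simp
  have "sym ((R \<union> R\<inverse>)\<^sup>*)" by (intro sym_rtrancl) (auto simp: sym_def)
  then have "(p, q) \<in> (R \<union> R\<inverse>)\<^sup>*" if "p < length w" "q < length w" for p q
    using up[OF that(1)] up[OF that(2)] by (meson rtrancl_trans symD)
  then have "bracket_equiv w = {..<length w} \<times> {..<length w}"
    unfolding bracket_equiv_def Let_def R_def[symmetric] by auto
  then show ?thesis
    unfolding bracket_classes_def quotient_def using assms(1) by auto
qed

lemma bracket_classes_isolated:
  assumes "matching w = {}" "dashes w = {}"
  shows "bracket_classes w = (\<lambda>p. {p}) ` {..<length w}"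
  unfolding bracket_classes_def bracket_equiv_def quotient_def assms by auto

lemma first_class_singleton [simp]: "first_class {X} = X"
  unfolding first_class_def by (rule arg_minI[where x = X]) auto

lemma last_class_singleton [simp]: "last_class {X} = X"
  unfolding last_class_def by (rule arg_maxI[where x = X]) auto

lemma Collect_in_insert:
  "{p \<in> insert a A. P p} = (if P a then insert a {p \<in> A. P p} else {p \<in> A. P p})"
  by auto

lemmas form_defs = combined_form_def right_form_def left_form_def
  begins_unmatched_closing_def ends_unmatched_opening_def unmatched_def

text \<open>The bracket words of the four tableaux to which the operators will be applied, with
  contributing cells \<open>c\<close> and \<open>d\<close>. In the first three words the matching and the dashes alternate and
  link the whole word; in the last one two closing brackets from different cells stay apart.\<close>

context
  fixes c d :: "nat \<times> nat"
begin

lemma classes_closing_opening_closing: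
  fixes w defines "w \<equiv> [(Closing, c), (Opening, c), (Closing, d)]"
  shows "combined_form w = {}" "left_form w = {}" "right_form w = {{0, 1, 2}}"
    "final_closing_cell w {0, 1, 2} = d"
proof -
  have m: "matching w = {(1, 2)}" by (simp add: w_def matching_def)
  have "(p, p + 1) \<in> matching w \<union> dashes w" if "p + 1 < length w" for p
    using that unfolding m dashes_def by (auto simp: w_def less_Suc_eq)
  then have "bracket_classes w = {{..<length w}}"
    by (rule bracket_classes_connected[rotated]) (auto simp: w_def)
  also have "{..<length w} = {0, 1, 2}" by (auto simp: w_def)
  finally have cl: "bracket_classes w = {{0, 1, 2}}" .
  show "combined_form w = {}" "left_form w = {}" "right_form w = {{0, 1, 2}}"
    unfolding form_defs cl m by (auto simp: w_def)
  show "final_closing_cell w {0, 1, 2} = d"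
    unfolding final_closing_cell_def Collect_in_insert by (simp add: w_def)
qed

lemma classes_closing_opening_twice:
  fixes w defines "w \<equiv> [(Closing, c), (Opening, c), (Closing, d), (Opening, d)]"
  shows "combined_form w = {{0, 1, 2, 3}}" "initial_closing_cell w {0, 1, 2, 3} = c"
proof -
  have m: "matching w = {(1, 2)}" by (simp add: w_def matching_def)
  have "(p, p + 1) \<in> matching w \<union> dashes w" if "p + 1 < length w" for p
    using that unfolding m dashes_def by (auto simp: w_def less_Suc_eq)
  then have "bracket_classes w = {{..<length w}}"
    by (rule bracket_classes_connected[rotated]) (auto simp: w_def)
  also have "{..<length w} = {0, 1, 2, 3}" by (auto simp: w_def)
  finally have cl: "bracket_classes w = {{0, 1, 2, 3}}" .
  show "combined_form w = {{0, 1, 2, 3}}"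
    unfolding form_defs cl m by (auto simp: w_def)
  show "initial_closing_cell w {0, 1, 2, 3} = c"
    unfolding initial_closing_cell_def Collect_in_insert by (simp add: w_def)
qed

lemma classes_opening_closing_opening:
  fixes w defines "w \<equiv> [(Opening, c), (Closing, d), (Opening, d)]"
  shows "combined_form w = {}" "right_form w = {}"
proof -
  have m: "matching w = {(0, 1)}" by (simp add: w_def matching_def)
  have "(p, p + 1) \<in> matching w \<union> dashes w" if "p + 1 < length w" for p
    using that unfolding m dashes_def by (auto simp: w_def less_Suc_eq)
  then have "bracket_classes w = {{..<length w}}"
    by (rule bracket_classes_connected[rotated]) (auto simp: w_def)
  also have "{..<length w} = {0, 1, 2}" by (auto simp: w_def)
  finally have cl: "bracket_classes w = {{0, 1, 2}}" .
  show "combined_form w = {}" "right_form w = {}"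
    unfolding form_defs cl m by (auto simp: w_def)
qed

lemma classes_closing_closing:
  fixes w defines "w \<equiv> [(Closing, c), (Closing, d)]"
  assumes "c \<noteq> d"
  shows "combined_form w = {}" "right_form w = {{0}, {1}}"
    "final_closing_cell w (last_class {{0}, {1}}) = d"
proof -
  have m: "matching w = {}" by (simp add: w_def matching_def)
  have dash: "dashes w = {}" using assms by (auto simp: dashes_def)
  have cl: "bracket_classes w = {{0}, {1}}"
    unfolding bracket_classes_isolated[OF m dash] by (auto simp: w_def)
  show "combined_form w = {}" "right_form w = {{0}, {1}}"
    unfolding form_defs cl m by (auto simp: w_def)
  have "last_class {{0}, {1}} = {1}"
    unfolding last_class_def by (rule arg_maxI[where x = "{1}"]) force+
  moreover have "{p \<in> {1}. fst (w ! p) = Closing} = {1}" by (auto simp: w_def)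
  ultimately show "final_closing_cell w (last_class {{0}, {1}}) = d"
    unfolding final_closing_cell_def by (simp add: w_def)
qed

end

section \<open>The double string\<close>

text \<open>Cells and positions are written with the numeral 1 from here on; rewriting it to \<open>Suc 0\<close> would
  hide them from the equations stated for them.\<close>

declare One_nat_def [simp del]

abbreviation "T0 \<equiv> tab21 {1} {2} {2, 3}"
abbreviation "T1 \<equiv> tab21 {1} {2, 3} {2, 3}"
abbreviation "T2 \<equiv> tab21 {1} {2, 3} {3}"

lemma T_in_SVT: "T0 \<in> SVT 3 [2, 1, 0]" "T1 \<in> SVT 3 [2, 1, 0]" "T2 \<in> SVT 3 [2, 1, 0]"
  by (simp_all add: tab21_in_SVT_iff)

lemma word_T0: "word_of 3 [2, 1, 0] 2 T0 = [(Closing, (2, 1)), (Opening, (2, 1)), (Closing, (1, 2))]"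
  by (simp add: word_of_tab21 contribution_def)

lemma word_T1:
  "word_of 3 [2, 1, 0] 2 T1 =
     [(Closing, (2, 1)), (Opening, (2, 1)), (Closing, (1, 2)), (Opening, (1, 2))]"
  by (simp add: word_of_tab21 contribution_def)

lemma word_T2:
  "word_of 3 [2, 1, 0] 2 T2 = [(Opening, (2, 1)), (Closing, (1, 2)), (Opening, (1, 2))]"
  by (simp add: word_of_tab21 contribution_def)

lemma f_T0: "f_op 3 [2, 1, 0] 2 T0 = Some T1"
proof -
  have "add_letter 3 (1, 2) T0 = T1"
    by (auto simp: add_letter_def tab21_def fun_eq_iff)
  then show ?thesis
    unfolding f_op_def word_T0 Let_def classes_closing_opening_closing last_class_singleton by simp
qed

lemma f_T1: "f_op 3 [2, 1, 0] 2 T1 = Some T2"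
proof -
  have "delete_letter 2 (2, 1) T1 = T2"
    by (auto simp: delete_letter_def tab21_def)
  then show ?thesis
    unfolding f_op_def word_T1 Let_def classes_closing_opening_twice first_class_singleton by simp
qed

lemma f_T2: "f_op 3 [2, 1, 0] 2 T2 = None"
  unfolding f_op_def word_T2 Let_def classes_opening_closing_opening by simp

lemma e_T0: "e_op 3 [2, 1, 0] 2 T0 = None"
  unfolding e_op_def word_T0 Let_def classes_closing_opening_closing by simp

text \<open>The one other tableau that adding a letter 3 could turn into \<open>T0\<close> is \<open>1 2/2\<close>. Its word is
  \<open>) )\<close>, and the operator acts on the last class, in the cell \<open>(1, 2)\<close> instead of \<open>(2, 1)\<close>.\<close>

lemma f_12_2: "f_op 3 [2, 1, 0] 2 (tab21 {1} {2} {2}) = Some (tab21 {1} {2, 3} {2})"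
proof -
  have w: "word_of 3 [2, 1, 0] 2 (tab21 {1} {2} {2}) = [(Closing, (2, 1)), (Closing, (1, 2))]"
    by (simp add: word_of_tab21 contribution_def)
  have "add_letter 3 (1, 2) (tab21 {1} {2} {2}) = tab21 {1} {2, 3} {2}"
    by (auto simp: add_letter_def tab21_def fun_eq_iff)
  then show ?thesis
    unfolding f_op_def w Let_def by (simp add: classes_closing_closing)
qed

lemma f_op_cases:
  assumes "f_op n lam i S = Some T"
  obtains p where "T = delete_letter i p S" | p where "T = add_letter (i + 1) p S"
proof (cases "combined_form (word_of n lam i S) = {}")
  case True
  let ?w = "word_of n lam i S"
  show thesis
    using True assms unfolding f_op_def Let_def
    by (intro that(2)[of "final_closing_cell ?w (last_class (right_form ?w))"])
      (simp split: if_splits)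
next
  case False
  let ?w = "word_of n lam i S"
  show thesis
    using False assms unfolding f_op_def Let_def
    by (intro that(1)[of "initial_closing_cell ?w (first_class (combined_form ?w))"]) simp
qed

lemma tab21_eq_iff: "tab21 A B C = tab21 A' B' C' \<longleftrightarrow> A = A' \<and> B = B' \<and> C = C'"
  by (metis tab21_apply(1,3,5))

text \<open>A preimage \<open>S\<close> agrees with \<open>T0\<close> off one cell. If a letter 2 was deleted there, that cell of
  \<open>T0\<close> has no 2, so within the diagram it is \<open>(1, 1)\<close>; but a 2 above the 2 in the cell \<open>(2, 1)\<close>
  breaks column strictness. If a letter 3 was added, the cell of \<open>T0\<close> contains 3, so it is
  \<open>(2, 1)\<close>. As deletion and insertion can be vacuous, \<open>S = T0\<close> has to be ruled out too; it is, since
  \<open>f_op\<close> maps \<open>T0\<close> to \<open>T1\<close>.\<close>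

lemma T0_not_in_image_f:
  assumes "S \<in> SVT 3 [2, 1, 0]"
  shows "f_op 3 [2, 1, 0] 2 S \<noteq> Some T0"
proof
  assume f: "f_op 3 [2, 1, 0] 2 S = Some T0"
  obtain A B C where S: "S = tab21 A B C" using assms by (rule SVT_210_is_tab21)
  have "A \<subseteq> {1..3}" "Max A < Min C" using assms by (auto simp: S tab21_in_SVT_iff)
  have "S = T0 \<or> S = tab21 {1} {2} {2}"
    using f
  proof (cases rule: f_op_cases)
    case (1 p)
    then have off: "S q = T0 q" if "q \<noteq> p" for q
      using that by (simp add: delete_letter_def)
    have at: "T0 p = S p - {2}" using 1 by (simp add: delete_letter_def)
    show ?thesis
    proof (cases "p = (1, 1)")
      case True
      then have "B = {2}" "C = {2, 3}" "A - {2} = {1}"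
        using off[of "(1, 2)"] off[of "(2, 1)"] at by (simp_all add: S)
      moreover have "2 \<notin> A"
      proof
        assume "2 \<in> A"
        moreover have "finite A" using \<open>A \<subseteq> {1..3}\<close> by (rule finite_subset) simp
        ultimately have "2 \<le> Max A" by simp
        then show False using \<open>Max A < Min C\<close> \<open>C = {2, 3}\<close> by simp
      qed
      ultimately show ?thesis by (simp add: S)
    next
      case False
      have "2 \<notin> T0 p" using at by simp
      then have "p \<noteq> (1, 2)" "p \<noteq> (2, 1)" by auto
      with False have "A = {1}" "B = {2}" "C = {2, 3}"
        using off[of "(1, 1)"] off[of "(1, 2)"] off[of "(2, 1)"] by (simp_all add: S)
      then show ?thesis by (simp add: S)
    qed
  next
    case (2 p)
    then have off: "S q = T0 q" if "q \<noteq> p" for q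
      using that by (simp add: add_letter_def)
    have at: "T0 p = insert 3 (S p)" using 2 by (simp add: add_letter_def)
    then have "3 \<in> T0 p" by simp
    then have p: "p = (2, 1)" by (auto simp: tab21_def fun_upd_def split: if_splits)
    then have "A = {1}" "B = {2}" "insert 3 C = {2, 3}"
      using off[of "(1, 1)"] off[of "(1, 2)"] at by (simp_all add: S)
    have "2 \<in> insert 3 C" "C \<subseteq> {2, 3}" using \<open>insert 3 C = {2, 3}\<close> by blast+
    then have "2 \<in> C" "C \<subseteq> {2, 3}" by simp_all
    then have "C = {2} \<or> C = {2, 3}" by blast
    then show ?thesis using \<open>A = {1}\<close> \<open>B = {2}\<close> by (auto simp: S)
  qed
  then show False using f f_T0 f_12_2 by (auto simp: tab21_eq_iff)
qed

lemma double_string_T: "double_string 3 [2, 1, 0] 2 [T0, T1, T2]"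
proof -
  have steps: "f_op 3 [2, 1, 0] 2 ([T0, T1, T2] ! j) = Some ([T0, T1, T2] ! (j + 1))"
    if "j + 1 < length [T0, T1, T2]" for j
  proof -
    from that have "j = 0 \<or> j = 1" by auto
    then show ?thesis by (elim disjE) (simp_all add: f_T0 f_T1)
  qed
  show ?thesis
    unfolding double_string_def
  proof (intro conjI allI impI ballI)
    show "odd (length [T0, T1, T2])" by simp
    show "set [T0, T1, T2] \<subseteq> SVT 3 [2, 1, 0]" by (simp add: T_in_SVT)
    show "e_op 3 [2, 1, 0] 2 (hd [T0, T1, T2]) = None" by (simp add: e_T0)
    show "f_op 3 [2, 1, 0] 2 (last [T0, T1, T2]) = None" by (simp add: f_T2)
    show "f_op 3 [2, 1, 0] 2 S \<noteq> Some (hd [T0, T1, T2])" if "S \<in> SVT 3 [2, 1, 0]" for S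
      using T0_not_in_image_f[OF that] by simp
  qed (rule steps)
qed

section \<open>Patterns with top row 0, 1, 2\<close>

lemma nu_tab21:
  "nu 3 [2, 1, 0] (tab21 A B C) k 1 = of_bool (Min A \<le> k) + of_bool (Min B \<le> k)"
  "nu 3 [2, 1, 0] (tab21 A B C) k 2 = of_bool (Min C \<le> k)"
  "nu 3 [2, 1, 0] (tab21 A B C) k 3 = 0"
proof -
  let ?N = "\<lambda>r. {c. (r, c) \<in> diagram 3 [2, 1, 0] \<and> Min (tab21 A B C (r, c)) \<le> k}"
  have N: "?N 1 = (if Min A \<le> k then {1} else {}) \<union> (if Min B \<le> k then {2} else {})"
    "?N 2 = (if Min C \<le> k then {1} else {})" "?N 3 = {}"
    unfolding diagram_210 by auto
  then show "nu 3 [2, 1, 0] (tab21 A B C) k 1 = of_bool (Min A \<le> k) + of_bool (Min B \<le> k)"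
    "nu 3 [2, 1, 0] (tab21 A B C) k 2 = of_bool (Min C \<le> k)"
    "nu 3 [2, 1, 0] (tab21 A B C) k 3 = 0"
    unfolding nu_def N by simp_all
qed

lemma gz_index_3: "gz_index 3 = {(1, 1), (1, 2), (2, 1)}"
  unfolding gz_index_def by auto

text \<open>The edges leaving row \<open>i\<close> are drawn once, when the scan reaches that row, from the edges above
  it; later rows leave them alone.\<close>

lemma up_edges_iff:
  assumes "1 \<le> i" "i \<le> m"
  shows "((i, j), q) \<in> edges_upto n a circ m \<longleftrightarrow>
    (i, j) \<in> circ \<and> q \<in> up_targets a (edges_upto n a circ (i - 1)) i j"
  using assms(2)
proof (induction m)
  case 0
  then show ?case using assms(1) by simp
next
  case (Suc m)
  have above: "fst (fst e) \<le> m" if "e \<in> edges_upto n a circ m" for e m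
    using that by (induction m) auto
  show ?case
  proof (cases "i = Suc m")
    case True
    then have "((i, j), q) \<notin> edges_upto n a circ m"
      using above[of "((i, j), q)" m] by auto
    with True show ?thesis by (cases q) auto
  next
    case False
    then show ?thesis using Suc by simp
  qed
qed

lemma nonminimal_positionsI:
  assumes "1 \<le> k" "k \<le> n - 1" "(r, c) \<in> diagram n lam" "k + 1 \<in> T (r, c)"
    "k + 1 \<noteq> Min (T (r, c))"
  shows "(n - k, k - r + 1) \<in> nonminimal_positions n lam T"
  using assms unfolding nonminimal_positions_def by blast

text \<open>The rows of both patterns increase strictly, so an entry equals at most one of its upper
  neighbours, and an encircled entry is joined to exactly that one, if it exists.\<close>

lemma pattern_T1:
  defines "P \<equiv> Phi 3 [2, 1, 0] T1"
  shows "entry P (0, 1) = 0" "entry P (0, 2) = 1" "entry P (0, 3) = 2"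
    "entry P (1, 1) = 1" "entry P (1, 2) = 2" "entry P (2, 1) = 1"
    "((1, 1), q) \<notin> edges P" "((1, 2), q) \<notin> edges P"
    "((2, 1), q) \<in> edges P \<longleftrightarrow> q = (1, 1)"
    "(1, 1) \<notin> encircled P" "(1, 2) \<notin> encircled P"
proof -
  let ?a = "gz_entry 3 [2, 1, 0] T1"
  let ?circ = "all_positions 3 - nonminimal_positions 3 [2, 1, 0] T1"
  have a: "?a (0, 1) = 0" "?a (0, 2) = 1" "?a (0, 3) = 2"
    "?a (1, 1) = 1" "?a (1, 2) = 2" "?a (2, 1) = 1"
    unfolding gz_entry_def by (simp_all add: nu_tab21)
  have "(1, 1) \<in> nonminimal_positions 3 [2, 1, 0] T1"
    using nonminimal_positionsI[of 2 3 2 1 "[2, 1, 0]" T1]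
    by (simp add: diagram_210 flip: One_nat_def)
  moreover have "(1, 2) \<in> nonminimal_positions 3 [2, 1, 0] T1"
    using nonminimal_positionsI[of 2 3 1 2 "[2, 1, 0]" T1]
    by (simp add: diagram_210 flip: One_nat_def)
  moreover have "(2, 1) \<notin> nonminimal_positions 3 [2, 1, 0] T1"
    unfolding nonminimal_positions_def diagram_210 by auto
  ultimately have circ: "(1, 1) \<notin> ?circ" "(1, 2) \<notin> ?circ" "(2, 1) \<in> ?circ"
    by (auto simp: all_positions_def)
  show "entry P (0, 1) = 0" "entry P (0, 2) = 1" "entry P (0, 3) = 2"
    "entry P (1, 1) = 1" "entry P (1, 2) = 2" "entry P (2, 1) = 1"
    "(1, 1) \<notin> encircled P" "(1, 2) \<notin> encircled P"
    using a circ by (simp_all add: P_def Phi_def Let_def)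
  have edges: "edges P = edges_upto 3 ?a ?circ 2"
    by (simp add: P_def Phi_def Let_def)
  show "((1, 1), q) \<notin> edges P" "((1, 2), q) \<notin> edges P"
    "((2, 1), q) \<in> edges P \<longleftrightarrow> q = (1, 1)"
    using circ a
    by (simp_all add: edges up_edges_iff up_targets_def flip: One_nat_def)
qed

lemma pattern_T2:
  defines "P \<equiv> Phi 3 [2, 1, 0] T2"
  shows "entry P (0, 1) = 0" "entry P (0, 2) = 1" "entry P (0, 3) = 2"
    "entry P (1, 1) = 0" "entry P (1, 2) = 2" "entry P (2, 1) = 1"
    "((1, 1), q) \<in> edges P \<longleftrightarrow> q = (0, 1)" "((1, 2), q) \<notin> edges P"
    "((2, 1), q) \<notin> edges P"
    "(1, 1) \<in> encircled P" "(1, 2) \<notin> encircled P" "(2, 1) \<in> encircled P"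
proof -
  let ?a = "gz_entry 3 [2, 1, 0] T2"
  let ?circ = "all_positions 3 - nonminimal_positions 3 [2, 1, 0] T2"
  have a: "?a (0, 1) = 0" "?a (0, 2) = 1" "?a (0, 3) = 2"
    "?a (1, 1) = 0" "?a (1, 2) = 2" "?a (2, 1) = 1"
    unfolding gz_entry_def by (simp_all add: nu_tab21)
  have "(1, 2) \<in> nonminimal_positions 3 [2, 1, 0] T2"
    using nonminimal_positionsI[of 2 3 1 2 "[2, 1, 0]" T2]
    by (simp add: diagram_210 flip: One_nat_def)
  moreover have "(1, 1) \<notin> nonminimal_positions 3 [2, 1, 0] T2"
    "(2, 1) \<notin> nonminimal_positions 3 [2, 1, 0] T2"
    unfolding nonminimal_positions_def diagram_210 by auto
  ultimately have circ: "(1, 1) \<in> ?circ" "(1, 2) \<notin> ?circ" "(2, 1) \<in> ?circ"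
    by (auto simp: all_positions_def)
  show "entry P (0, 1) = 0" "entry P (0, 2) = 1" "entry P (0, 3) = 2"
    "entry P (1, 1) = 0" "entry P (1, 2) = 2" "entry P (2, 1) = 1"
    "(1, 1) \<in> encircled P" "(1, 2) \<notin> encircled P" "(2, 1) \<in> encircled P"
    using a circ by (simp_all add: P_def Phi_def Let_def)
  have edges: "edges P = edges_upto 3 ?a ?circ 2"
    by (simp add: P_def Phi_def Let_def)
  show "((1, 1), q) \<in> edges P \<longleftrightarrow> q = (0, 1)" "((1, 2), q) \<notin> edges P"
    "((2, 1), q) \<notin> edges P"
    using circ a
    by (simp_all add: edges up_edges_iff up_targets_def flip: One_nat_def)
qed

section \<open>The two cells\<close>

lemma top_row:
  "with_top_row [2, 1, 0] 3 y (0, 1) = 0" "with_top_row [2, 1, 0] 3 y (0, 2) = 1"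
  "with_top_row [2, 1, 0] 3 y (0, 3) = 2" "1 \<le> i \<Longrightarrow> with_top_row [2, 1, 0] 3 y (i, j) = y (i, j)"
  by (simp_all add: with_top_row_def row_len_def)

lemma pre_cell_T1:
  "pre_cell 3 [2, 1, 0] (Phi 3 [2, 1, 0] T1) =
     {y \<in> topspace (gz_space 3). 0 < y (1, 1) \<and> y (1, 1) < 1 \<and> 1 < y (1, 2) \<and> y (1, 2) < 2 \<and>
        y (2, 1) = y (1, 1)}"
proof -
  have one: "2 - 1 = (1::nat)" by simp
  show ?thesis
    unfolding pre_cell_def Let_def gz_index_3
    by (simp add: pattern_T1 top_row one del: topspace_product_topology)
qed

lemma pre_cell_T2:
  "pre_cell 3 [2, 1, 0] (Phi 3 [2, 1, 0] T2) =
     {y \<in> topspace (gz_space 3). y (1, 1) = 0 \<and> 1 < y (1, 2) \<and> y (1, 2) < 2 \<and> y (2, 1) = 1}"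
proof -
  have one: "2 - 1 = (1::nat)" by simp
  show ?thesis
    unfolding pre_cell_def Let_def gz_index_3
    by (simp add: pattern_T2 top_row one del: topspace_product_topology) auto
qed

lemma GZ_210:
  "GZ 3 [2, 1, 0] = {y \<in> topspace (gz_space 3).
     0 \<le> y (1, 1) \<and> y (1, 1) \<le> 1 \<and> 1 \<le> y (1, 2) \<and> y (1, 2) \<le> 2 \<and>
     y (1, 1) \<le> y (2, 1) \<and> y (2, 1) \<le> y (1, 2)}"
  unfolding GZ_def Let_def gz_index_3
  by (simp add: top_row del: topspace_product_topology flip: One_nat_def)

lemma continuous_map_coordinate:
  "p \<in> gz_index n \<Longrightarrow> continuous_map (gz_space n) euclideanreal (\<lambda>y. y p)"
  by (rule continuous_map_product_projection)

lemma cell_closure_subset: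
  assumes "closedin (gz_space n) F" "pre_cell n lam (Phi n lam T) \<subseteq> F"
  shows "cell_closure n (cell_of n lam T) \<subseteq> F"
proof (rule closure_of_minimal[OF _ assms(1)])
  show "cell_of n lam T \<subseteq> F"
    using assms(2) unfolding cell_of_def cell_of_pattern_def Let_def by blast
qed

text \<open>The two cells will be separated by the difference of these two coordinates: it is constant on
  each of them, and a linear equation survives the passage to the closure.\<close>

lemma closure_in_hyperplane:
  assumes "pre_cell 3 lam (Phi 3 lam T) \<subseteq> {y. y (2, 1) - y (1, 1) = d}"
  shows "cell_closure 3 (cell_of 3 lam T) \<subseteq> {y. y (2, 1) - y (1, 1) = d}"
proof -
  let ?F = "{y \<in> topspace (gz_space 3). y (2, 1) - y (1, 1) \<in> {d}}"
  have "closedin (gz_space 3) ?F"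
    by (intro closedin_continuous_map_preimage[of _ euclideanreal] continuous_map_diff
        continuous_map_coordinate) (simp_all add: gz_index_3)
  moreover have "pre_cell 3 lam (Phi 3 lam T) \<subseteq> ?F"
    using assms unfolding pre_cell_def by blast
  ultimately have "cell_closure 3 (cell_of 3 lam T) \<subseteq> ?F"
    by (rule cell_closure_subset)
  then show ?thesis by blast
qed

lemma closures_disjoint:
  "cell_closure 3 (cell_of 3 [2, 1, 0] T1) \<inter> cell_closure 3 (cell_of 3 [2, 1, 0] T2) = {}"
proof -
  have "cell_closure 3 (cell_of 3 [2, 1, 0] T1) \<subseteq> {y. y (2, 1) - y (1, 1) = 0}"
    by (rule closure_in_hyperplane) (auto simp: pre_cell_T1)
  moreover have "cell_closure 3 (cell_of 3 [2, 1, 0] T2) \<subseteq> {y. y (2, 1) - y (1, 1) = 1}"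
    by (rule closure_in_hyperplane) (auto simp: pre_cell_T2)
  moreover have "{y :: point. y (2, 1) - y (1, 1) = 0} \<inter> {y. y (2, 1) - y (1, 1) = 1} = {}"
    by auto
  ultimately show ?thesis by blast
qed

text \<open>Without a point in \<open>C\<^bsub>T2\<^esub>\<close> the disjointness of the closures would not refute
  \<open>C\<^bsub>T2\<^esub> \<subseteq> closure C\<^bsub>T1\<^esub>\<close>. The pre-cell is an open segment in the direction of the coordinate
  \<open>(1, 2)\<close>; its affine span \<open>L\<close> lies in the line carrying the segment, along which the
  defining inequalities of \<open>GZ\<close> amount to \<open>1 \<le> y (1, 2) \<le> 2\<close>. So the pre-cell is open in \<open>L\<close> and the
  intersection with the relative interior removes nothing.\<close>

lemma cell_T2_nonempty: "cell_of 3 [2, 1, 0] T2 \<noteq> {}"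
proof -
  define C where "C = pre_cell 3 [2, 1, 0] (Phi 3 [2, 1, 0] T2)"
  define L where "L = affine_span (gz_index 3) C"
  define U where "U = {y \<in> topspace (gz_space 3). y (1, 2) \<in> {1<..<2}}"
  define A where "A = {y \<in> topspace (gz_space 3). y (1, 1) = 0 \<and> y (2, 1) = 1}"
  have "affine_in (gz_index 3) A"
    unfolding affine_in_def A_def by (auto simp: gz_index_3)
  moreover have "C \<subseteq> A" unfolding C_def A_def pre_cell_T2 by auto
  ultimately have "L \<subseteq> A" unfolding L_def affine_span_def by (rule hull_minimal[rotated])
  have "openin (gz_space 3) U"
    unfolding U_def by (intro openin_continuous_map_preimage[of _ euclideanreal]
        continuous_map_coordinate) (simp_all add: gz_index_3)
  then have "openin (subtopology (gz_space 3) L) (U \<inter> L)"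
    by (auto simp: openin_subtopology)
  moreover have "U \<inter> L \<subseteq> GZ 3 [2, 1, 0] \<inter> L"
    using \<open>L \<subseteq> A\<close> unfolding U_def A_def GZ_210 by auto
  ultimately have "U \<inter> L \<subseteq> subtopology (gz_space 3) L interior_of (GZ 3 [2, 1, 0] \<inter> L)"
    by (rule interior_of_maximal[rotated])
  moreover have "C \<subseteq> U" unfolding C_def U_def pre_cell_T2 by auto
  moreover have "C \<subseteq> L" unfolding L_def affine_span_def by (rule hull_subset)
  ultimately have "cell_of 3 [2, 1, 0] T2 = C"
    unfolding cell_of_def cell_of_pattern_def Let_def C_def[symmetric] L_def[symmetric] by blast
  \<comment> \<open>the midpoint of the segment\<close>
  moreover have "(\<lambda>p \<in> gz_index 3. if p = (1, 1) then 0 else if p = (1, 2) then 3 / 2 else 1) \<in> C"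
    unfolding C_def pre_cell_T2 by (simp add: gz_index_3)
  ultimately show ?thesis by auto
qed

theorem theorem6p2p2:
  fixes face_of_cell :: "nat \<Rightarrow> nat list \<Rightarrow> point set \<Rightarrow> point set \<Rightarrow> bool"
  assumes "is_face_notion face_of_cell"
  shows
    "\<not> (\<forall>n lam i Ts. n \<ge> 1 \<and> is_partition n lam \<and> 1 \<le> i \<and> i \<le> n - 1 \<and> double_string n lam i Ts \<longrightarrow>
          (\<forall>j. 2 * j + 2 < length Ts \<longrightarrow>
             face_of_cell n lam (cell_of n lam (Ts ! (2 * j))) (cell_of n lam (Ts ! (2 * j + 1))) \<and>
             face_of_cell n lam (cell_of n lam (Ts ! (2 * j + 2))) (cell_of n lam (Ts ! (2 * j + 1)))))
     \<and> (let lam = [2, 1, 0];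
            T0 = tab21 {1} {2} {2, 3};
            T1 = tab21 {1} {2, 3} {2, 3};
            T2 = tab21 {1} {2, 3} {3}
        in f_op 3 lam 2 T0 = Some T1 \<and> f_op 3 lam 2 T1 = Some T2 \<and>
           double_string 3 lam 2 [T0, T1, T2] \<and>
           cell_closure 3 (cell_of 3 lam T1) \<inter> cell_closure 3 (cell_of 3 lam T2) = {} \<and>
           \<not> face_of_cell 3 lam (cell_of 3 lam T2) (cell_of 3 lam T1))"
proof -
  let ?C = "\<lambda>T. cell_of 3 [2, 1, 0] T"
  have part: "is_partition 3 [2, 1, 0]" by (simp add: is_partition_def)
  have "?C T2 \<subseteq> topspace (gz_space 3)"
    unfolding cell_of_def cell_of_pattern_def Let_def pre_cell_def by blast
  then have "?C T2 \<subseteq> cell_closure 3 (?C T2)" by (rule closure_of_subset)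
  then have "\<not> ?C T2 \<subseteq> cell_closure 3 (?C T1)"
    using closures_disjoint cell_T2_nonempty by blast
  moreover have "?C T2 \<subseteq> cell_closure 3 (?C T1)" if "face_of_cell 3 [2, 1, 0] (?C T2) (?C T1)"
    using assms that part T_in_SVT(2,3) unfolding is_face_notion_def
    by (meson one_le_numeral)
  ultimately have not_face: "\<not> face_of_cell 3 [2, 1, 0] (?C T2) (?C T1)" by blast
  have "\<not> (\<forall>n lam i Ts. n \<ge> 1 \<and> is_partition n lam \<and> 1 \<le> i \<and> i \<le> n - 1 \<and>
        double_string n lam i Ts \<longrightarrow>
          (\<forall>j. 2 * j + 2 < length Ts \<longrightarrow>
             face_of_cell n lam (cell_of n lam (Ts ! (2 * j))) (cell_of n lam (Ts ! (2 * j + 1))) \<and>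
             face_of_cell n lam (cell_of n lam (Ts ! (2 * j + 2))) (cell_of n lam (Ts ! (2 * j + 1)))))"
    (is "\<not> ?all")
  proof
    assume ?all
    from this[rule_format, of 3 "[2, 1, 0]" 2 "[T0, T1, T2]" 0]
    have "face_of_cell 3 [2, 1, 0] (?C T2) (?C T1)"
      using part double_string_T by simp
    with not_face show False by blast
  qed
  then show ?thesis
    unfolding Let_def using f_T0 f_T1 double_string_T closures_disjoint not_face by blast
qed

end
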